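(* Let $X$ be a normed space, let $\theta=(k_r)$ be a lacunary sequence and let $f$ be a $\theta$-compatible modulus function. Then $S_\theta=S_\theta^f$.
   Context: A modulus function is a function $f:\mathbb{R}^+\to\mathbb{R}^+$ (with $\mathbb{R}^+=[0,\infty)$) such that: (1) $f(x)=0$ if and only if $x=0$; (2) $f(x+y)\le f(x)+f(y)$ for all $x,y\in\mathbb{R}^+$; (3) $f$ is increasing ($x\le y$ implies $f(x)\le f(y)$); (4) $f$ is continuous from the right at $0$. All modulus functions are assumed to be unbounded. A lacunary sequence is a (strictly) increasing sequence $\theta=(k_r)_{r\ge 0}$ of natural numbers with $k_0=0$ such that $h_r:=k_r-k_{r-1}\to\infty$ as $r\to\infty$. Put $I_r=(k_{r-1},k_r]\cap\mathbb{N}$ for $r\ge1$. The modulus function $f$ is $\theta$-compatible if $\lim_{\varepsilon\to0^+}\varphi_\theta(\varepsilon)=0$, where $\varphi_\theta(\varepsilon)=\limsup_{r\to\infty}\frac{f(h_r\varepsilon)}{f(h_r)}$. For a normed space $(X,\|\cdot\|)$, with $\#$ denoting cardinality: - $S_\theta$ (lacunary statistically convergent sequences) is the set of sequences $(x_n)_{n\ge1}$ in $X$ for which there is $L\in X$ such that for every $\varepsilon>0$, $\lim_{r\to\infty}\frac{1}{h_r}\#\{k\in I_r:\|x_k-L\|>\varepsilon\}=0$. - $S_\theta^f$ (lacunary $f$-statistically convergent sequences) is the set of sequences $(x_n)_{n\ge1}$ in $X$ for which there is $L\in X$ such that for every $\varepsilon>0$, $\lim_{r\to\infty}\frac{1}{f(h_r)}f\left(\#\{k\in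 I_r:\|x_k-L\|>\varepsilon\}\right)=0$. *)

theory Defs
  imports "HOL-Analysis.Analysis"
begin

text \<open>
  A function on the nonnegative reals is represented by a function \<open>f :: real \<Rightarrow> real\<close>; only its values
  on \<open>{0..}\<close> are ever constrained or used.  As a standing convention, modulus functions
  are unbounded.
\<close>

definition modulus_function :: "(real \<Rightarrow> real) \<Rightarrow> bool" where
  "modulus_function f \<longleftrightarrow>
     (\<forall>x\<ge>0. f x \<ge> 0) \<and>
     (\<forall>x\<ge>0. f x = 0 \<longleftrightarrow> x = 0) \<and>
     (\<forall>x\<ge>0. \<forall>y\<ge>0. f (x + y) \<le> f x + f y) \<and>
     mono_on {0..} f \<and>
     continuous (at_right 0) f \<and>
     \<not> bdd_above (f ` {0..})"

text \<open>
  The gaps and blocks below are meant for \<open>r \<ge> 1\<close>. For \<open>r = 0\<close> they degenerate to \<open>0\<close> and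
  \<open>{}\<close>, which does not affect any limit as \<open>r \<rightarrow> \<infinity>\<close>.
\<close>

definition gap :: "(nat \<Rightarrow> nat) \<Rightarrow> nat \<Rightarrow> nat" where
  "gap k r = k r - k (r - 1)"

definition block :: "(nat \<Rightarrow> nat) \<Rightarrow> nat \<Rightarrow> nat set" where
  "block k r = {k (r - 1)<..k r}"

definition lacunary :: "(nat \<Rightarrow> nat) \<Rightarrow> bool" where
  "lacunary k \<longleftrightarrow> k 0 = 0 \<and> strict_mono k \<and> filterlim (gap k) at_top sequentially"

text \<open>The upper limit is taken in the extended reals, so that it always exists.\<close>

definition compat_phi :: "(nat \<Rightarrow> nat) \<Rightarrow> (real \<Rightarrow> real) \<Rightarrow> real \<Rightarrow> ereal" where
  "compat_phi k f \<epsilon> = limsup (\<lambda>r. ereal (f (real (gap k r) * \<epsilon>) / f (real (gap k r))))"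

definition theta_compatible :: "(nat \<Rightarrow> nat) \<Rightarrow> (real \<Rightarrow> real) \<Rightarrow> bool" where
  "theta_compatible k f \<longleftrightarrow> (compat_phi k f \<longlongrightarrow> 0) (at_right 0)"

text \<open>
  A sequence \<open>(x\<^sub>n)\<close>, \<open>n \<ge> 1\<close>, is represented by a function on \<open>nat\<close>.  Since \<open>0\<close> lies in no block,
  the value at \<open>0\<close> is irrelevant for membership in the two sets below.
\<close>

definition lac_stat_conv :: "(nat \<Rightarrow> nat) \<Rightarrow> (nat \<Rightarrow> 'a::real_normed_vector) set" where
  "lac_stat_conv k =
     {x. \<exists>L. \<forall>\<epsilon>>0.
        (\<lambda>r. 1 / real (gap k r) * real (card {n \<in> block k r. norm (x n - L) > \<epsilon>})) \<longlonglongrightarrow> 0}"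

definition lac_f_stat_conv ::
    "(nat \<Rightarrow> nat) \<Rightarrow> (real \<Rightarrow> real) \<Rightarrow> (nat \<Rightarrow> 'a::real_normed_vector) set" where
  "lac_f_stat_conv k f =
     {x. \<exists>L. \<forall>\<epsilon>>0.
        (\<lambda>r. 1 / f (real (gap k r)) * f (real (card {n \<in> block k r. norm (x n - L) > \<epsilon>}))) \<longlonglongrightarrow> 0}"

end

theory Submission
  imports Defs
begin

text \<open>
  Compatibility says that \<open>f (h\<^sub>r \<delta>) / f (h\<^sub>r)\<close> is eventually small for small \<open>\<delta>\<close>; as \<open>f\<close> is
  increasing, counts \<open>c\<^sub>r = o(h\<^sub>r)\<close> then satisfy \<open>f (c\<^sub>r) = o(f (h\<^sub>r))\<close>. Conversely, \<open>c\<^sub>r \<ge> h\<^sub>r / m\<close>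
  forces \<open>f (h\<^sub>r) \<le> m f (c\<^sub>r)\<close> by subadditivity, so \<open>f (c\<^sub>r) = o(f (h\<^sub>r))\<close> gives \<open>c\<^sub>r = o(h\<^sub>r)\<close>
  for every modulus function.
\<close>

lemma modulus_function_mono:
  assumes "modulus_function f" "0 \<le> x" "x \<le> y"
  shows "f x \<le> f y"
  using assms by (auto simp: modulus_function_def intro: mono_onD)

lemma modulus_function_pos:
  assumes "modulus_function f" "0 < x"
  shows "0 < f x"
  using assms unfolding modulus_function_def by (metis less_eq_real_def less_irrefl)

lemma modulus_function_nonneg:
  assumes "modulus_function f" "0 \<le> x"
  shows "0 \<le> f x"
  using assms unfolding modulus_function_def by simp

lemma modulus_function_mult_le:
  assumes f: "modulus_function f" and x: "0 \<le> x"
  shows "f (real m * x) \<le> real m * f x"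
proof (induction m)
  case 0
  have "f 0 = 0" using f unfolding modulus_function_def by (metis order_refl)
  then show ?case by simp
next
  case (Suc m)
  have "f (real m * x + x) \<le> f (real m * x) + f x"
    using f x unfolding modulus_function_def by simp
  with Suc show ?case by (simp add: algebra_simps)
qed

text \<open>At \<open>r = 0\<close> the gap is \<open>0\<close> and both normalised quotients divide
  by zero; a positive gap makes both denominators positive, so that they can be cleared.\<close>

lemma eventually_gap_pos:
  assumes "lacunary k"
  shows "\<forall>\<^sub>F r in sequentially. 0 < gap k r"
proof -
  have "\<forall>\<^sub>F r in sequentially. 1 \<le> gap k r"
    using assms unfolding lacunary_def filterlim_at_top by blast
  then show ?thesis by eventually_elim simp
qed

text \<open>For given \<open>e\<close> a single \<open>\<delta>\<close> suffices: once
  \<open>c r\<close> lies below \<open>\<delta>\<close> times the gap, monotonicity transfers the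
  compatibility bound to \<open>f (c r)\<close>.\<close>

lemma theta_compatible_modulus_ratio_tendsto_0:
  assumes f: "modulus_function f" and k: "lacunary k" and comp: "theta_compatible k f"
    and c: "\<And>r. 0 \<le> c r" and lim: "(\<lambda>r. 1 / real (gap k r) * c r) \<longlonglongrightarrow> 0"
  shows "(\<lambda>r. 1 / f (real (gap k r)) * f (c r)) \<longlonglongrightarrow> 0"
proof (rule tendstoI)
  fix e :: real assume e: "0 < e"
  have "\<forall>\<^sub>F \<delta> in at_right 0. compat_phi k f \<delta> < ereal e"
    using comp e unfolding theta_compatible_def by (intro order_tendstoD(2)[of _ 0]) auto
  then have "\<forall>\<^sub>F \<delta> in at_right 0. compat_phi k f \<delta> < ereal e \<and> 0 < \<delta>"
    using eventually_at_right_less[of "0::real"] by eventually_elim simp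
  \<comment> \<open>The filter \<open>at_right 0\<close> is nontrivial, so the eventual bound has an
    actual witness, fixed before \<open>r\<close> varies.\<close>
  then obtain \<delta> where \<delta>: "0 < \<delta>" and "compat_phi k f \<delta> < ereal e"
    by (metis (mono_tags, lifting) eventually_happens trivial_limit_at_right_real)
  then have "\<forall>\<^sub>F r in sequentially. f (real (gap k r) * \<delta>) / f (real (gap k r)) < e"
    unfolding compat_phi_def by (auto dest: Limsup_lessD)
  moreover have "\<forall>\<^sub>F r in sequentially. 1 / real (gap k r) * c r < \<delta>"
    using lim \<delta> by (rule order_tendstoD(2))
  ultimately show "\<forall>\<^sub>F r in sequentially. dist (1 / f (real (gap k r)) * f (c r)) 0 < e"
    using eventually_gap_pos[OF k]
  proof eventually_elim
    case (elim r)
    have "c r \<le> real (gap k r) * \<delta>"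
      using elim(2,3) by (simp add: field_simps)
    then have "f (c r) \<le> f (real (gap k r) * \<delta>)"
      using c by (rule modulus_function_mono[OF f, rotated])
    moreover have "0 < f (real (gap k r))"
      using modulus_function_pos[OF f] elim(3) by simp
    ultimately have "f (c r) / f (real (gap k r)) < e"
      using elim(1) by (meson divide_right_mono le_less_trans less_imp_le)
    moreover have "0 \<le> f (c r) / f (real (gap k r))"
      using modulus_function_nonneg[OF f c] modulus_function_nonneg[OF f] by simp
    ultimately show ?case by simp
  qed
qed

lemma modulus_ratio_tendsto_0D:
  assumes f: "modulus_function f" and k: "lacunary k"
    and c: "\<And>r. 0 \<le> c r" and lim: "(\<lambda>r. 1 / f (real (gap k r)) * f (c r)) \<longlonglongrightarrow> 0"
  shows "(\<lambda>r. 1 / real (gap k r) * c r) \<longlonglongrightarrow> 0"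
proof (rule tendstoI)
  fix e :: real assume "0 < e"
  \<comment> \<open>The integer \<open>m\<close> serves twice: \<open>inverse m\<close> bounds the
    ratio of \<open>f\<close>-values, and the same bound then passes to the ratio of the arguments.
    Being an integer, \<open>m\<close> allows iterated subadditivity.\<close>
  then obtain m where m: "0 < m" "inverse (real m) < e"
    using ex_inverse_of_nat_less by blast
  have "\<forall>\<^sub>F r in sequentially. 1 / f (real (gap k r)) * f (c r) < inverse (real m)"
    using lim m by (intro order_tendstoD(2)) auto
  then show "\<forall>\<^sub>F r in sequentially. dist (1 / real (gap k r) * c r) 0 < e"
    using eventually_gap_pos[OF k]
  proof eventually_elim
    case (elim r)
    have pos: "0 < f (real (gap k r))"
      using modulus_function_pos[OF f] elim(2) by simp
    have "real m * c r < real (gap k r)"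
    \<comment> \<open>Otherwise \<open>f\<close> of the gap is at most \<open>m * f (c r)\<close>,
      so the ratio of \<open>f\<close>-values is at least \<open>inverse m\<close>.\<close>
    proof (rule ccontr)
      assume "\<not> real m * c r < real (gap k r)"
      then have "f (real (gap k r)) \<le> f (real m * c r)"
        by (intro modulus_function_mono[OF f]) auto
      also have "\<dots> \<le> real m * f (c r)"
        using f c by (rule modulus_function_mult_le)
      finally show False
        using elim(1) pos m by (simp add: field_simps)
    qed
    then have "c r / real (gap k r) < inverse (real m)"
      using elim(2) m by (simp add: field_simps)
    then show ?case using m c[of r] by simp
  qed
qed

theorem theorem3p2:
  fixes k :: "nat \<Rightarrow> nat" and f :: "real \<Rightarrow> real"
  assumes "lacunary k"
    and "modulus_function f"
    and "theta_compatible k f"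
  shows "(lac_stat_conv k :: (nat \<Rightarrow> 'a::real_normed_vector) set) = lac_f_stat_conv k f"
proof -
  \<comment> \<open>The equivalence holds for every sequence of counts, hence for each
    \<open>L\<close> and \<open>\<epsilon>\<close> separately; the same \<open>L\<close> is a limit
    in both senses.\<close>
  have "(\<lambda>r. 1 / real (gap k r) * real (c r)) \<longlonglongrightarrow> 0 \<longleftrightarrow>
      (\<lambda>r. 1 / f (real (gap k r)) * f (real (c r))) \<longlonglongrightarrow> 0" for c :: "nat \<Rightarrow> nat"
    using theta_compatible_modulus_ratio_tendsto_0[OF assms(2,1,3), of "\<lambda>r. real (c r)"]
      modulus_ratio_tendsto_0D[OF assms(2,1), of "\<lambda>r. real (c r)"] by auto
  then show ?thesis
    unfolding lac_stat_conv_def lac_f_stat_conv_def by simp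
qed

end
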